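(* Let $\Omega$ be a disk of radius $R>0$ and let $(m_n(h))_{n\ge1}$ be a sequence of elements of $\mathbb{Z}$ which satisfies, for every $n\ge1$, $$m_n(h)\in\arg\min\big\{|m+\mathfrak{t}_h|\,:\ m\in\mathbb{Z}\setminus\{m_1(h),\dots,m_{n-1}(h)\}\big\}\setminus\{m_1(h),\dots,m_{n-1}(h)\}.$$ Then for all $n\ge1$, $$\lambda_n(\mathfrak{Q}_h^{\mathrm{eff}})=|m_n(h)+\mathfrak{t}_h|^2-\frac{1}{12R^2}.$$
   Context: Here $h>0$. For a bounded simply connected planar domain $\Omega$ with analytic boundary, area $|\Omega|$, boundary length $|\partial\Omega|$ and boundary curvature $\kappa$ (a function of the arc length $s$), let $$\mathfrak{Q}_h^{\mathrm{eff}}=(D_s+\mathfrak{t}_h)^2-\frac{\kappa^2}{12},\qquad D_s=-i\partial_s,\qquad \mathfrak{t}_h=\frac{|\Omega|}{h|\partial\Omega|}-\frac{a_0}{h^{1/2}}+\frac{\pi}{|\partial\Omega|},$$ a differential operator on the boundary, acting on $L^2(\mathbb{R}/(|\partial\Omega|\mathbb{Z}))$; $\lambda_n(\mathfrak{Q}_h^{\mathrm{eff}})$ denotes its $n$-th eigenvalue (in non-decreasing order, counted with multiplicity). $a_0\in(0,\sqrt2)$ is the following constant. Let $\mathbb{R}^2_+=\mathbb{R}\times(0,\infty)$ and $\mathbf{A}_0=(-x_2,0)$. Let $\mathfrak{H}^2_{-\mathbf{A}_0}(\mathbb{R}^2_+)$ be the set of functions $u=u_1+u_2$ with $u_1\in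 H^1(\mathbb{R}^2_+)$ and $u_2\in L^2(\mathbb{R}^2_+)$ such that $(-i\partial_{x_1}-x_2+i(-i\partial_{x_2}))u_2=0$ and $u_2$ has a boundary trace in $L^2(\mathbb{R})$. For $\alpha\ge0$, $$\nu(\alpha)=\inf_{\substack{u\in\mathfrak{H}^2_{-\mathbf{A}_0}(\mathbb{R}^2_+)\\ u\ne0}}\frac{\int_{\mathbb{R}^2_+}|(-i\partial_{x_1}-x_2+i(-i\partial_{x_2}))u|^2\,\mathrm{d}x_1\mathrm{d}x_2+\alpha\int_{\mathbb{R}}|u(x_1,0)|^2\,\mathrm{d}x_1}{\|u\|^2_{L^2(\mathbb{R}^2_+)}}$$ (the numerator being $+\infty$ when the first integral diverges). Then $a_0$ is the unique positive solution of $\nu(\alpha)=\alpha^2$.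
   Formalization: The integer m is replaced by m/R both in the argmin (|m/R + t_h|) and in the eigenvalue formula (|m_n(h)/R + t_h|² − 1/(12R²)), since in arc length D_s has eigenvalues m/R on a circle of radius R; the printed formula holds only for R = 1. *)

theory Defs
  imports "HOL-Analysis.Analysis" "HOL-Library.Function_Algebras"
begin

section \<open>The constant \<open>a\<^sub>0\<close>\<close>

definition half_plane :: "(real \<times> real) set" where
  "half_plane = {x. 0 < snd x}"

definition sq_integrable_on :: "'a::euclidean_space set \<Rightarrow> ('a \<Rightarrow> complex) \<Rightarrow> bool" where
  "sq_integrable_on A u \<longleftrightarrow>
     set_borel_measurable lborel A u \<and> set_integrable lborel A (\<lambda>x. (cmod (u x))\<^sup>2)"

definition sq_norm :: "'a::euclidean_space set \<Rightarrow> ('a \<Rightarrow> complex) \<Rightarrow> ennreal" where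
  "sq_norm A u = (\<integral>\<^sup>+ x\<in>A. ennreal ((cmod (u x))\<^sup>2) \<partial>lborel)"

text \<open>In \<open>smooth2\<close>, \<open>D i j\<close> is the partial derivative of order \<open>i\<close> in the first and \<open>j\<close> in the second
  variable.\<close>

definition smooth2 :: "(real \<times> real \<Rightarrow> complex) \<Rightarrow> bool" where
  "smooth2 \<phi> \<longleftrightarrow> (\<exists>D :: nat \<Rightarrow> nat \<Rightarrow> real \<times> real \<Rightarrow> complex. D 0 0 = \<phi> \<and>
     (\<forall>i j x. (D i j has_derivative
        (\<lambda>y. of_real (fst y) * D (Suc i) j x + of_real (snd y) * D i (Suc j) x)) (at x)))"

definition partial1 :: "(real \<times> real \<Rightarrow> complex) \<Rightarrow> real \<times> real \<Rightarrow> complex" where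
  "partial1 \<phi> x = frechet_derivative \<phi> (at x) (1, 0)"

definition partial2 :: "(real \<times> real \<Rightarrow> complex) \<Rightarrow> real \<times> real \<Rightarrow> complex" where
  "partial2 \<phi> x = frechet_derivative \<phi> (at x) (0, 1)"

definition test_function :: "(real \<times> real) set \<Rightarrow> (real \<times> real \<Rightarrow> complex) \<Rightarrow> bool" where
  "test_function U \<phi> \<longleftrightarrow>
     smooth2 \<phi> \<and> (\<exists>K. compact K \<and> K \<subseteq> U \<and> (\<forall>x. x \<notin> K \<longrightarrow> \<phi> x = 0))"

definition H1_half_plane :: "(real \<times> real \<Rightarrow> complex) \<Rightarrow> bool" where
  "H1_half_plane u \<longleftrightarrow> sq_integrable_on half_plane u \<and>
     (\<exists>g1 g2. sq_integrable_on half_plane g1 \<and> sq_integrable_on half_plane g2 \<and>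
        (\<forall>\<phi>. test_function half_plane \<phi> \<longrightarrow>
           (LINT x:half_plane|lborel. u x * partial1 \<phi> x)
             = - (LINT x:half_plane|lborel. g1 x * \<phi> x) \<and>
           (LINT x:half_plane|lborel. u x * partial2 \<phi> x)
             = - (LINT x:half_plane|lborel. g2 x * \<phi> x)))"

text \<open>The operator \<open>d = -i\<partial>\<^sub>1 - x\<^sub>2 + i(-i\<partial>\<^sub>2) = -i\<partial>\<^sub>1 - x\<^sub>2 + \<partial>\<^sub>2\<close> has the formal (bilinear) transpose
  \<open>i\<partial>\<^sub>1 - x\<^sub>2 - \<partial>\<^sub>2\<close>.\<close>

definition d_transpose :: "(real \<times> real \<Rightarrow> complex) \<Rightarrow> real \<times> real \<Rightarrow> complex" where
  "d_transpose \<phi> x = \<i> * partial1 \<phi> x - of_real (snd x) * \<phi> x - partial2 \<phi> x"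

definition loc_integrable_half_plane :: "(real \<times> real \<Rightarrow> complex) \<Rightarrow> bool" where
  "loc_integrable_half_plane v \<longleftrightarrow> set_borel_measurable lborel half_plane v \<and>
     (\<forall>K. compact K \<longrightarrow> set_integrable lborel (half_plane \<inter> K) v)"

text \<open>\<open>weak_d u v\<close>: \<open>d u = v\<close> in the sense of distributions in the open half-plane.\<close>

definition weak_d :: "(real \<times> real \<Rightarrow> complex) \<Rightarrow> (real \<times> real \<Rightarrow> complex) \<Rightarrow> bool" where
  "weak_d u v \<longleftrightarrow> loc_integrable_half_plane v \<and>
     (\<forall>\<phi>. test_function half_plane \<phi> \<longrightarrow>
        (LINT x:half_plane|lborel. v x * \<phi> x) = (LINT x:half_plane|lborel. u x * d_transpose \<phi> x))"

text \<open>\<open>L2_trace u g\<close>: \<open>g \<in> L\<^sup>2(\<real>)\<close> is the boundary trace of \<open>u\<close>. For functions with \<open>d u\<close> locally integrable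
  up to the boundary the trace is characterised by Green's formula for \<open>d\<close>, tested against functions
  that need not vanish on the boundary; for \<open>u \<in> H\<^sup>1\<close> this is the usual Sobolev trace.\<close>

definition L2_trace :: "(real \<times> real \<Rightarrow> complex) \<Rightarrow> (real \<Rightarrow> complex) \<Rightarrow> bool" where
  "L2_trace u g \<longleftrightarrow> sq_integrable_on UNIV g \<and> (\<exists>v. weak_d u v \<and>
     (\<forall>\<phi>. test_function UNIV \<phi> \<longrightarrow>
        (LINT x:half_plane|lborel. v x * \<phi> x)
          = (LINT x:half_plane|lborel. u x * d_transpose \<phi> x)
            - (LINT x1|lborel. g x1 * \<phi> (x1, 0))))"

definition H2_space :: "(real \<times> real \<Rightarrow> complex) set" where
  "H2_space = {u. \<exists>u1 u2. u = (\<lambda>x. u1 x + u2 x) \<and> H1_half_plane u1 \<and>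
     sq_integrable_on half_plane u2 \<and> weak_d u2 (\<lambda>_. 0) \<and> (\<exists>g. L2_trace u2 g)}"

text \<open>The weak image \<open>v\<close> of \<open>u\<close> under \<open>d\<close> and the trace \<open>g\<close> are unique up to null sets. If \<open>v\<close> is not square
  integrable, the numerator is infinite.\<close>

definition nu :: "real \<Rightarrow> ennreal" where
  "nu \<alpha> = Inf {(sq_norm half_plane v + ennreal \<alpha> * sq_norm UNIV g) / sq_norm half_plane u | u v g.
     u \<in> H2_space \<and> sq_norm half_plane u \<noteq> 0 \<and> weak_d u v \<and> L2_trace u g}"

definition a0 :: real where
  "a0 = (THE \<alpha>. 0 < \<alpha> \<and> nu \<alpha> = ennreal (\<alpha>\<^sup>2))"


section \<open>Boundary curves\<close>

text \<open>The plane is identified with \<open>\<complex>\<close>. \<open>arclength_param \<gamma> L \<Gamma>\<close>: \<open>\<gamma>\<close> is a twice continuously differentiable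
  parametrisation by arc length of the closed simple curve \<open>\<Gamma>\<close>, whose length is \<open>L\<close>. The
  orientation is left open: reversing it replaces \<open>\<kappa>\<close> by \<open>-\<kappa>\<close>, of which only the square is used.\<close>

definition arclength_param :: "(real \<Rightarrow> complex) \<Rightarrow> real \<Rightarrow> complex set \<Rightarrow> bool" where
  "arclength_param \<gamma> L \<Gamma> \<longleftrightarrow> 0 < L \<and>
     (\<forall>s. \<gamma> (s + L) = \<gamma> s) \<and> inj_on \<gamma> {0..<L} \<and> \<gamma> ` {0..<L} = \<Gamma> \<and>
     (\<exists>\<gamma>' \<gamma>''. continuous_on UNIV \<gamma>'' \<and>
        (\<forall>s. (\<gamma> has_vector_derivative \<gamma>' s) (at s) \<and> (\<gamma>' has_vector_derivative \<gamma>'' s) (at s) \<and>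
             cmod (\<gamma>' s) = 1))"

text \<open>\<open>\<gamma>'' = \<kappa> \<cdot> i\<gamma>'\<close> for a curve parametrised by arc length.\<close>

definition curvature :: "(real \<Rightarrow> complex) \<Rightarrow> real \<Rightarrow> real" where
  "curvature \<gamma> s =
     (let \<gamma>' = (\<lambda>r. vector_derivative \<gamma> (at r))
      in Im (cnj (\<gamma>' s) * vector_derivative \<gamma>' (at s)))"


section \<open>The effective operator\<close>

text \<open>Operators on \<open>L\<^sup>2(\<real>/L\<int>)\<close> are given by their graphs, as relations between \<open>L\<close>-periodic
  functions, in which the second argument matters only up to null sets. An element of
  \<open>H\<^sup>1(\<real>/L\<int>)\<close> is represented by its continuous representative.

  \<open>H1_deriv L u v\<close>: \<open>u \<in> H\<^sup>1(\<real>/L\<int>)\<close> and \<open>u' = v\<close>.\<close>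

definition H1_deriv :: "real \<Rightarrow> (real \<Rightarrow> complex) \<Rightarrow> (real \<Rightarrow> complex) \<Rightarrow> bool" where
  "H1_deriv L u v \<longleftrightarrow> (\<forall>s. u (s + L) = u s) \<and> (\<forall>s. v (s + L) = v s) \<and>
     v \<in> borel_measurable lborel \<and> sq_integrable_on {0..L} v \<and>
     (\<forall>a b. a \<le> b \<longrightarrow> u b - u a = (LINT s:{a..b}|lborel. v s))"

text \<open>\<open>(D\<^sub>s + t) u = f\<close> with \<open>D\<^sub>s = -i\<partial>\<^sub>s\<close> and domain \<open>H\<^sup>1(\<real>/L\<int>)\<close>.\<close>

definition shifted_momentum :: "real \<Rightarrow> real \<Rightarrow> (real \<Rightarrow> complex) \<Rightarrow> (real \<Rightarrow> complex) \<Rightarrow> bool" where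
  "shifted_momentum L t u f \<longleftrightarrow> (\<exists>v. H1_deriv L u v \<and>
     (AE s in lborel. f s = - \<i> * v s + of_real t * u s))"

definition t_eff :: "real \<Rightarrow> complex set \<Rightarrow> real \<Rightarrow> real" where
  "t_eff h \<Omega> L = measure lborel \<Omega> / (h * L) - a0 / sqrt h + pi / L"

text \<open>\<open>((D\<^sub>s + t)\<^sup>2 - \<kappa>\<^sup>2/12) u = f\<close>. Since \<open>w\<close> is again in the domain of \<open>D\<^sub>s + t\<close>, the domain
  is \<open>H\<^sup>2(\<real>/L\<int>)\<close>. Here \<open>\<gamma>\<close> is an arc-length parametrisation of the boundary of \<open>\<Omega>\<close>
  and \<open>L\<close> is the length of the boundary.

  In the arc-length variable on a circle of radius \<open>R\<close> the Fourier modes are \<open>exp (i k s / R)\<close> with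
  \<open>k \<in> \<int>\<close>, so \<open>D\<^sub>s\<close> has the eigenvalues \<open>k / R\<close>. A formula with \<open>k\<close> in place of \<open>k / R\<close> holds
  only for \<open>R = 1\<close>.\<close>

definition Q_eff ::
  "real \<Rightarrow> complex set \<Rightarrow> real \<Rightarrow> (real \<Rightarrow> complex) \<Rightarrow> (real \<Rightarrow> complex) \<Rightarrow> (real \<Rightarrow> complex) \<Rightarrow> bool" where
  "Q_eff h \<Omega> L \<gamma> u f \<longleftrightarrow> (\<exists>w g. shifted_momentum L (t_eff h \<Omega> L) u w \<and>
     shifted_momentum L (t_eff h \<Omega> L) w g \<and>
     (AE s in lborel. f s = g s - of_real ((curvature \<gamma> s)\<^sup>2 / 12) * u s))"


section \<open>Eigenvalues counted with multiplicity\<close>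

global_interpretation cfun: vector_space "\<lambda>(c::complex) (f::real \<Rightarrow> complex) x. c * f x"
  by unfold_locales (auto simp: algebra_simps fun_eq_iff)

definition eigenspace ::
  "((real \<Rightarrow> complex) \<Rightarrow> (real \<Rightarrow> complex) \<Rightarrow> bool) \<Rightarrow> complex \<Rightarrow> (real \<Rightarrow> complex) set" where
  "eigenspace T z = {u. T u (\<lambda>s. z * u s)}"

text \<open>\<open>e 1 \<le> e 2 \<le> \<dots>\<close> lists all eigenvalues, each one as often as the (finite) dimension of its
  eigenspace; the value \<open>e 0\<close> plays no role.\<close>

definition eigenvalue_enumeration ::
  "((real \<Rightarrow> complex) \<Rightarrow> (real \<Rightarrow> complex) \<Rightarrow> bool) \<Rightarrow> (nat \<Rightarrow> real) \<Rightarrow> bool" where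
  "eigenvalue_enumeration T e \<longleftrightarrow> (\<forall>i j. 1 \<le> i \<longrightarrow> i \<le> j \<longrightarrow> e i \<le> e j) \<and>
     (\<forall>z. finite {n. 1 \<le> n \<and> of_real (e n) = z} \<and>
        (\<exists>B. finite B \<and> \<not> cfun.dependent B \<and> cfun.span B = eigenspace T z \<and>
             card B = card {n. 1 \<le> n \<and> of_real (e n) = z}))"

definition nth_eigenvalue ::
  "((real \<Rightarrow> complex) \<Rightarrow> (real \<Rightarrow> complex) \<Rightarrow> bool) \<Rightarrow> nat \<Rightarrow> real" where
  "nth_eigenvalue T n = (THE x. \<exists>e. eigenvalue_enumeration T e \<and> e n = x)"

end

theory Submission
  imports Defs
begin

text \<open>
  On a circle the curvature has the constant square \<open>1 / R\<^sup>2\<close>, so the effective operator is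
  \<open>(D\<^sub>s + t)\<^sup>2 - 1 / (12 R\<^sup>2)\<close> on \<open>\<real> / 2\<pi>R\<int>\<close>. It has constant coefficients and is diagonal in the Fourier
  modes \<open>exp (i k s / R)\<close>, with the eigenvalues \<open>(k / R + t)\<^sup>2 - 1 / (12 R\<^sup>2)\<close>. The integers \<open>m 1, m 2, \<dots>\<close> run
  through all \<open>k\<close> in the order of increasing \<open>\<bar>k / R + t\<bar>\<close>, hence of increasing eigenvalue.

  Four points need an argument.

  \<^item> An arc-length parametrisation of the circle is shown to be \<open>c + r\<^sub>0 exp (\<plusminus> i s / R)\<close>. This gives
    the curvature, and injectivity on one period forces \<open>L = 2\<pi>R\<close> (\<open>arclength_param_sphere\<close>).
  \<^item> The operator is defined by weak derivatives. Since \<open>H\<^sup>1\<close> functions on the circle are continuous, an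
    eigenfunction \<open>u\<close> and \<open>w = (D\<^sub>s + t) u\<close> solve a linear first-order system with continuous right-hand
    side, so they are classical solutions (\<open>Q_eff_eigenspace_iff_classical\<close>).
  \<^item> With \<open>\<mu> = z + 1 / (12 R\<^sup>2)\<close> and \<open>\<rho>\<^sup>2 = \<mu>\<close>, each of \<open>w \<plusminus> \<rho> u\<close> solves a scalar equation: it is a
    periodic multiple of a complex exponential, hence zero or a multiple of a Fourier mode. If \<open>\<mu> = 0\<close>, the two
    coincide and periodicity excludes a further solution that grows linearly. So the
    eigenspace of \<open>z\<close> is spanned by the modes with \<open>(k / R + t)\<^sup>2 = \<mu>\<close>
    (\<open>eigenspace_eq_span_fourier_modes\<close>). The modes are linearly independent, which gives the
    multiplicities (\<open>independent_fourier_modes\<close>).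
  \<^item> The \<open>n\<close>-th eigenvalue is defined by a description operator, so the enumeration of the eigenvalues has
    to be unique (\<open>eigenvalue_enumeration_unique\<close>), and \<open>m\<close> has to reach every integer
    (\<open>greedy_enumeration_bij\<close>).
\<close>

section \<open>First-order linear equations\<close>

lemma has_vector_derivative_exp_linear:
  fixes a :: complex
  shows "((\<lambda>s. exp (a * of_real s)) has_vector_derivative a * exp (a * of_real s)) (at s)"
proof -
  have "((\<lambda>z. exp (a * z)) has_field_derivative a * exp (a * of_real s)) (at (of_real s))"
    by (auto intro!: derivative_eq_intros)
  from has_vector_derivative_real_field[OF this] show ?thesis by simp
qed

lemma exponential_of_ode:
  fixes p :: "real \<Rightarrow> complex"
  assumes "\<And>s. (p has_vector_derivative a * p s) (at s)"
  shows "p s = p 0 * exp (a * of_real s)"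
proof -
  let ?f = "\<lambda>s::real. p s * exp (- (a * of_real s))"
  have "(?f has_vector_derivative 0) (at s within UNIV)" for s :: real
    using has_vector_derivative_mult[OF assms has_vector_derivative_exp_linear[of "- a"], of s]
    by (simp add: algebra_simps)
  then obtain c where c: "\<And>s. ?f s = c"
    using has_vector_derivative_zero_constant[OF convex_UNIV, of ?f] by auto
  have "p s * exp (- (a * of_real s)) = p 0"
    using c[of s] c[of 0] by simp
  then show ?thesis
    by (simp add: exp_minus field_simps)
qed

lemma periodic_of_int_mult:
  fixes f :: "real \<Rightarrow> 'a"
  assumes per: "\<And>s. f (s + L) = f s"
  shows "f (s + of_int n * L) = f s"
proof (induction n rule: int_induct[where k = 0])
  case (step1 i)
  then show ?case using per[of "s + of_int i * L"] by (simp add: algebra_simps)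
next
  case (step2 i)
  then show ?case using per[of "s + of_int (i - 1) * L"] by (simp add: algebra_simps)
qed simp

section \<open>The circle\<close>

text \<open>Differentiating \<open>\<bar>\<gamma> - c\<bar>\<^sup>2 = R\<^sup>2\<close> shows that \<open>\<gamma>'\<close> is orthogonal to \<open>r = \<gamma> - c\<close>, and both have constant
  modulus, so \<open>\<gamma>' = (\<sigma> / R) r\<close> with \<open>\<sigma> = \<plusminus>i\<close>. The sign cannot jump, by continuity, and so \<open>r\<close> solves a linear
  equation with constant coefficient. Everything is read off from its solution.\<close>

lemma arclength_param_sphere:
  assumes "0 < R" and \<gamma>: "arclength_param \<gamma> L (sphere c R)"
  shows arclength_param_sphere_length: "L = 2 * pi * R"
    and arclength_param_sphere_curvature: "(curvature \<gamma> s)\<^sup>2 = 1 / R\<^sup>2"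
proof -
  from \<gamma> obtain \<gamma>' \<gamma>'' where L: "0 < L" and per: "\<And>s. \<gamma> (s + L) = \<gamma> s"
    and inj: "inj_on \<gamma> {0..<L}" and img: "\<gamma> ` {0..<L} = sphere c R"
    and d1: "\<And>s. (\<gamma> has_vector_derivative \<gamma>' s) (at s)"
    and d2: "\<And>s. (\<gamma>' has_vector_derivative \<gamma>'' s) (at s)"
    and speed: "\<And>s. cmod (\<gamma>' s) = 1"
    unfolding arclength_param_def by blast
  define r where "r s = \<gamma> s - c" for s
  have dr: "(r has_vector_derivative \<gamma>' s) (at s)" for s
    unfolding r_def using d1[of s] by (auto intro!: derivative_eq_intros)
  have per_n: "\<gamma> (s + of_int n * L) = \<gamma> s" for s n
    using per by (rule periodic_of_int_mult)
  have norm_r: "cmod (r s) = R" for s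
  proof -
    have "s - of_int \<lfloor>s / L\<rfloor> * L \<in> {0..<L}"
      using L floor_divide_lower[of L s] floor_divide_upper[of L s] by (simp add: algebra_simps)
    then have "\<gamma> (s - of_int \<lfloor>s / L\<rfloor> * L) \<in> sphere c R"
      using img by blast
    then show ?thesis
      using per_n[of "s - of_int \<lfloor>s / L\<rfloor> * L" "\<lfloor>s / L\<rfloor>"]
      by (simp add: r_def dist_norm norm_minus_commute)
  qed
  have rr: "cnj (r s) * r s = of_real (R\<^sup>2)" for s
    using norm_r[of s] by (metis complex_norm_square mult.commute of_real_power)
  have Re0: "Re (cnj (r s) * \<gamma>' s) = 0" for s
  proof -
    have "((\<lambda>s. r s \<bullet> r s) has_vector_derivative (r s \<bullet> \<gamma>' s + \<gamma>' s \<bullet> r s)) (at s)"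
      by (rule bounded_bilinear.has_vector_derivative[OF bounded_bilinear_inner dr dr])
    moreover have "(\<lambda>s. r s \<bullet> r s) = (\<lambda>s. R\<^sup>2)"
      using norm_r by (simp add: power2_norm_eq_inner[symmetric])
    ultimately have "r s \<bullet> \<gamma>' s + \<gamma>' s \<bullet> r s = 0"
      using vector_derivative_unique_at has_vector_derivative_const by metis
    then show ?thesis by (simp add: inner_complex_def algebra_simps)
  qed
  \<comment> \<open>The ratio of \<open>\<gamma>'\<close> to \<open>r / R\<close>, written without division by \<open>r\<close>: it is the \<open>\<sigma>\<close> above.\<close>
  define q where "q s = cnj (r s) * \<gamma>' s / of_real R" for s
  have q_values: "q s \<in> {\<i>, - \<i>}" for s
  proof -
    have "Re (q s) = 0" using Re0[of s] by (simp add: q_def)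
    moreover have "cmod (q s) = 1"
      using norm_r[of s] speed[of s] \<open>0 < R\<close> by (simp add: q_def norm_mult norm_divide)
    ultimately have "Im (q s) = 1 \<or> Im (q s) = - 1"
      by (auto simp: cmod_def abs_if split: if_splits)
    with \<open>Re (q s) = 0\<close> show ?thesis by (auto simp: complex_eq_iff)
  qed
  have "continuous_on UNIV q"
  proof -
    have "continuous_on UNIV r" "continuous_on UNIV \<gamma>'"
      using dr d2 by (auto simp: continuous_on_eq_continuous_at intro: has_vector_derivative_continuous)
    then show ?thesis unfolding q_def using \<open>0 < R\<close> by (intro continuous_intros) auto
  qed
  moreover have "finite (range q)"
    using q_values by (auto intro: finite_subset[of _ "{\<i>, - \<i>}"])
  ultimately have "q constant_on UNIV"
    by (intro continuous_finite_range_constant) auto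
  then obtain \<sigma> where \<sigma>: "\<And>s. q s = \<sigma>" unfolding constant_on_def by auto
  have \<sigma>_values: "\<sigma> = \<i> \<or> \<sigma> = - \<i>" using q_values[of 0] \<sigma> by auto
  have \<gamma>'_eq: "\<gamma>' s = \<sigma> / of_real R * r s" for s
  proof -
    have "\<sigma> * r s = (cnj (r s) * r s) * \<gamma>' s / of_real R"
      unfolding \<sigma>[of s, symmetric] q_def by (simp add: mult_ac)
    also have "\<dots> = of_real R * \<gamma>' s" using \<open>0 < R\<close> by (simp add: rr power2_eq_square)
    finally show ?thesis using \<open>0 < R\<close> by (simp add: field_simps)
  qed
  have r_eq: "r s = r 0 * exp (\<sigma> / of_real R * of_real s)" for s
    by (rule exponential_of_ode) (use dr \<gamma>'_eq in simp)
  have r0: "r 0 \<noteq> 0" using norm_r[of 0] \<open>0 < R\<close> by auto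
  have "exp (\<sigma> / of_real R * of_real L) = 1"
    using r_eq[of L] per[of 0] r0 by (simp add: r_def)
  then obtain n :: int where "Im (\<sigma> / of_real R * of_real L) = of_int (2 * n) * pi"
    by (auto simp: exp_eq_1)
  then have "\<exists>k::int. L = of_int k * (2 * pi * R)"
    using \<sigma>_values \<open>0 < R\<close>
    by (auto simp: field_simps intro: exI[of _ n] exI[of _ "- n"])
  then obtain k :: int where k: "L = of_int k * (2 * pi * R)" by blast
  have "0 < of_int k * (2 * pi * R)" using k L by simp
  then have "1 \<le> k" using \<open>0 < R\<close> by (simp add: zero_less_mult_iff mult_less_0_iff)
  \<comment> \<open>If \<open>L\<close> were a proper multiple of \<open>2\<pi>R\<close>, the curve would return to its start too early.\<close>
  moreover have "\<not> 2 \<le> k"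
  proof
    assume "2 \<le> k"
    then have "1 * (2 * pi * R) < of_int k * (2 * pi * R)"
      using \<open>0 < R\<close> by (intro mult_strict_right_mono) auto
    then have "2 * pi * R \<in> {0..<L}" "0 \<in> {0..<L}" using k \<open>0 < R\<close> L by auto
    moreover have "exp (\<sigma> / of_real R * of_real (2 * pi * R)) = 1"
      using \<sigma>_values \<open>0 < R\<close> by (auto simp: exp_eq_1 intro: exI[of _ 1] exI[of _ "-1"])
    then have "\<gamma> (2 * pi * R) = \<gamma> 0"
      using r_eq[of "2 * pi * R"] by (simp add: r_def)
    ultimately show False using inj \<open>0 < R\<close> by (auto dest: inj_onD)
  qed
  ultimately show "L = 2 * pi * R" using k by (simp add: order_antisym)
  have "\<gamma>'' s = \<sigma> / of_real R * \<gamma>' s"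
  proof -
    have "((\<lambda>s. \<sigma> / of_real R * r s) has_vector_derivative \<sigma> / of_real R * \<gamma>' s) (at s)"
      by (intro has_vector_derivative_mult_right dr)
    moreover have "(\<lambda>s. \<sigma> / of_real R * r s) = \<gamma>'" using \<gamma>'_eq by auto
    ultimately show ?thesis using d2 vector_derivative_unique_at by metis
  qed
  then have "curvature \<gamma> s = Im (cnj (\<gamma>' s) * (\<sigma> / of_real R * \<gamma>' s))"
    by (simp only: curvature_def Let_def vector_derivative_at[OF d1] vector_derivative_at[OF d2])
  also have "cnj (\<gamma>' s) * (\<sigma> / of_real R * \<gamma>' s) = \<sigma> / of_real R * (\<gamma>' s * cnj (\<gamma>' s))"
    by (simp add: mult_ac)
  also have "\<gamma>' s * cnj (\<gamma>' s) = 1"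
    using speed[of s] complex_norm_square[of "\<gamma>' s"] by simp
  finally have "curvature \<gamma> s = Im \<sigma> / R" by simp
  then show "(curvature \<gamma> s)\<^sup>2 = 1 / R\<^sup>2"
    using \<sigma>_values by (elim disjE) (simp_all add: power_divide)
qed

section \<open>Classical solutions\<close>

text \<open>By periodicity \<open>v\<close> is square integrable, hence integrable, on every cell \<open>[nL, (n+1)L]\<close>. Near a given
  point \<open>u\<close> is thus the indefinite integral of an integrable function.\<close>

lemma H1_deriv_imp_continuous:
  assumes "0 < L" and uv: "H1_deriv L u v"
  shows "continuous_on UNIV u"
proof -
  have per: "v (s + L) = v s" for s using uv by (auto simp: H1_deriv_def)
  have meas [measurable]: "v \<in> borel_measurable borel" using uv by (auto simp: H1_deriv_def)
  have sq: "set_integrable lborel {0..L} (\<lambda>x. (cmod (v x))\<^sup>2)"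
    using uv by (auto simp: H1_deriv_def sq_integrable_on_def)
  have cell0: "set_integrable lborel {0..L} v"
  proof (rule set_integrable_bound)
    show "set_integrable lborel {0..L} (\<lambda>x. 1 + (cmod (v x))\<^sup>2)"
      by (intro set_integral_add sq borel_integrable_atLeastAtMost') auto
    show "set_borel_measurable lborel {0..L} v"
      unfolding set_borel_measurable_def by measurable
    have "cmod z \<le> 1 + (cmod z)\<^sup>2" for z
      using zero_le_power2[of "cmod z - 1"] norm_ge_zero[of z]
      unfolding power2_diff power_one mult_1_right by linarith
    then show "AE x in lborel. x \<in> {0..L} \<longrightarrow> norm (v x) \<le> norm (1 + (cmod (v x))\<^sup>2)"
      by (auto simp: abs_of_nonneg)
  qed
  have per_n: "v (s + of_int n * L) = v s" for s n
    using per by (rule periodic_of_int_mult)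
  have cell: "set_integrable lborel {of_int n * L..of_int n * L + L} v" for n
  proof -
    have "integrable lborel (\<lambda>x. indicator {0..L} (- (of_int n * L) + 1 * x) *\<^sub>R v (- (of_int n * L) + 1 * x))"
      using cell0 unfolding set_integrable_def
      by (intro lborel_integrable_real_affine[of "\<lambda>x. indicator {0..L} x *\<^sub>R v x"]) auto
    moreover have "indicator {0..L} (- (of_int n * L) + 1 * x) = (indicator {of_int n * L..of_int n * L + L} x :: real)"
      "v (- (of_int n * L) + 1 * x) = v x" for x
      using per_n[of "x - of_int n * L" n] by (auto simp: indicator_def)
    ultimately show ?thesis unfolding set_integrable_def by (simp only:)
  qed
  have "isCont u s" for s
  proof -
    \<comment> \<open>Three consecutive cells, the middle one containing \<open>s\<close>, so that \<open>s\<close> is an interior point.\<close>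
    define n where "n = \<lfloor>s / L\<rfloor> - 1"
    define a b where "a = of_int n * L" and "b = a + L + L + L"
    have "of_int \<lfloor>s / L\<rfloor> * L = a + L" by (simp add: a_def n_def algebra_simps)
    with \<open>0 < L\<close> have "a < s" "s < b"
      using floor_divide_lower[of L s] floor_divide_upper[of L s]
      by (simp_all add: b_def distrib_right)
    have "of_int (n + 1) * L = a + L" "of_int (n + 2) * L = a + L + L"
      by (simp_all add: a_def algebra_simps)
    then have "set_integrable lborel {a..a + L} v"
      "set_integrable lborel {a + L..a + L + L} v" "set_integrable lborel {a + L + L..b} v"
      using cell[of n] cell[of "n + 1"] cell[of "n + 2"] by (simp_all only: a_def b_def)
    then have "set_integrable lborel ({a..a + L} \<union> {a + L..a + L + L} \<union> {a + L + L..b}) v"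
      by (intro set_integrable_Un) simp_all
    then have int: "set_integrable lborel {a..b} v"
      by (rule set_integrable_subset) (auto simp: b_def)
    have u_eq: "u x = u a + integral {a..x} v" if "x \<in> {a..b}" for x
    proof -
      have "set_integrable lborel {a..x} v"
        using int by (rule set_integrable_subset) (use that in auto)
      then have "(LINT s:{a..x}|lborel. v s) = integral {a..x} v"
        by (rule set_borel_integral_eq_integral)
      moreover have "u x - u a = (LINT s:{a..x}|lborel. v s)"
        using uv that by (auto simp: H1_deriv_def)
      ultimately show ?thesis by (simp add: algebra_simps)
    qed
    have "continuous_on {a..b} (\<lambda>x. u a + integral {a..x} v)"
      using set_borel_integral_eq_integral(1)[OF int]
      by (intro continuous_intros indefinite_integral_continuous_1)
    then have "continuous_on {a..b} u"
      by (rule continuous_on_eq) (rule u_eq[symmetric])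
    then show ?thesis
      using \<open>a < s\<close> \<open>s < b\<close> by (intro continuous_on_interior[of "{a..b}"]) simp_all
  qed
  then show ?thesis by (simp add: continuous_on_eq_continuous_at)
qed

lemma H1_deriv_imp_has_vector_derivative:
  assumes uv: "H1_deriv L u v" and AE: "AE s in lborel. v s = \<phi> s"
    and cont: "continuous_on UNIV \<phi>"
  shows "(u has_vector_derivative \<phi> s) (at s)"
proof -
  have [measurable]: "v \<in> borel_measurable borel" using uv by (auto simp: H1_deriv_def)
  have [measurable]: "\<phi> \<in> borel_measurable borel"
    using cont by (rule borel_measurable_continuous_onI)
  have u_eq: "u x = u (s - 1) + integral {s - 1..x} \<phi>" if "x \<in> {s - 1..s + 1}" for x
  proof -
    have "u x - u (s - 1) = (LINT s:{s - 1..x}|lborel. v s)"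
      using uv that by (auto simp: H1_deriv_def)
    also have "\<dots> = (LINT s:{s - 1..x}|lborel. \<phi> s)"
      by (rule set_lebesgue_integral_cong_AE) (use AE in auto)
    also have "\<dots> = integral {s - 1..x} \<phi>"
      by (intro set_borel_integral_eq_integral borel_integrable_atLeastAtMost')
        (use cont in \<open>auto intro: continuous_on_subset\<close>)
    finally show ?thesis by (simp add: algebra_simps)
  qed
  have "((\<lambda>x. integral {s - 1..x} \<phi>) has_vector_derivative \<phi> s) (at s within {s - 1..s + 1})"
    by (rule integral_has_vector_derivative) (use cont in \<open>auto intro: continuous_on_subset\<close>)
  then have "((\<lambda>x. u (s - 1) + integral {s - 1..x} \<phi>) has_vector_derivative \<phi> s) (at s within {s - 1..s + 1})"
    by (auto intro!: derivative_eq_intros)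
  then have "(u has_vector_derivative \<phi> s) (at s within {s - 1..s + 1})"
    using has_vector_derivative_transform[of s "{s - 1..s + 1}", OF _ u_eq] by simp
  then show ?thesis by (simp add: at_within_Icc_at)
qed

text \<open>Continuously differentiable solutions are weak ones. The periodicity of \<open>\<phi>\<close> is inherited from \<open>u\<close> by uniqueness of derivatives.\<close>

lemma H1_deriv_of_C1:
  assumes per: "\<And>s. u (s + L) = u s"
    and deriv: "\<And>s. (u has_vector_derivative \<phi> s) (at s)"
    and cont: "continuous_on UNIV \<phi>"
  shows "H1_deriv L u \<phi>"
  unfolding H1_deriv_def sq_integrable_on_def
proof (intro conjI allI impI)
  have [measurable]: "\<phi> \<in> borel_measurable borel"
    using cont by (rule borel_measurable_continuous_onI)
  show "u (s + L) = u s" for s by (rule per)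
  show "\<phi> (s + L) = \<phi> s" for s
  proof -
    have "((\<lambda>s. u (s + L)) has_vector_derivative \<phi> (s + L)) (at s)"
    proof -
      have "((\<lambda>s. s + L) has_vector_derivative 1) (at s)"
        by (simp add: has_vector_derivative_def has_derivative_add_const)
      from vector_diff_chain_at[OF this deriv] show ?thesis by (simp add: o_def)
    qed
    moreover have "(\<lambda>s. u (s + L)) = u" using per by auto
    ultimately show ?thesis using deriv vector_derivative_unique_at by metis
  qed
  show "\<phi> \<in> borel_measurable lborel" by simp
  show "set_borel_measurable lborel {0..L} \<phi>"
    unfolding set_borel_measurable_def by measurable
  show "set_integrable lborel {0..L} (\<lambda>x. (cmod (\<phi> x))\<^sup>2)"
    by (intro borel_integrable_atLeastAtMost' continuous_intros)
      (use cont in \<open>auto intro: continuous_on_subset\<close>)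
  fix a b :: real
  assume "a \<le> b"
  have "(LINT s:{a..b}|lborel. \<phi> s) = integral {a..b} \<phi>"
    by (intro set_borel_integral_eq_integral borel_integrable_atLeastAtMost')
      (use cont in \<open>auto intro: continuous_on_subset\<close>)
  also have "\<dots> = u b - u a"
    using \<open>a \<le> b\<close> deriv
    by (intro integral_unique fundamental_theorem_of_calculus)
      (auto intro: has_vector_derivative_at_within)
  finally show "u b - u a = (LINT s:{a..b}|lborel. \<phi> s)" ..
qed

lemma shifted_momentum_imp_continuous:
  "0 < L \<Longrightarrow> shifted_momentum L t u f \<Longrightarrow> continuous_on UNIV u"
  unfolding shifted_momentum_def using H1_deriv_imp_continuous by blast

text \<open>The regularity step: \<open>u' = i (w - t u)\<close> holds almost everywhere, and its right-hand side is
  continuous because \<open>u\<close>, being in \<open>H\<^sup>1\<close>, is. Integrating shows that \<open>u\<close> is continuously differentiable and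
  that the equation holds at every point.\<close>

lemma shifted_momentum_iff_classical:
  assumes "0 < L" and w: "continuous_on UNIV w"
  shows "shifted_momentum L t u w \<longleftrightarrow>
    (\<forall>s. u (s + L) = u s) \<and>
    (\<forall>s. (u has_vector_derivative \<i> * (w s - of_real t * u s)) (at s))"
proof
  assume sm: "shifted_momentum L t u w"
  then obtain v where v: "H1_deriv L u v" and AE: "AE s in lborel. w s = - \<i> * v s + of_real t * u s"
    unfolding shifted_momentum_def by blast
  have "continuous_on UNIV u" using \<open>0 < L\<close> sm by (rule shifted_momentum_imp_continuous)
  then have cont: "continuous_on UNIV (\<lambda>s. \<i> * (w s - of_real t * u s))"
    by (intro continuous_intros w)
  have "AE s in lborel. v s = \<i> * (w s - of_real t * u s)"
    using AE by eventually_elim simp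
  from H1_deriv_imp_has_vector_derivative[OF v this cont] v
  show "(\<forall>s. u (s + L) = u s) \<and>
    (\<forall>s. (u has_vector_derivative \<i> * (w s - of_real t * u s)) (at s))"
    by (auto simp: H1_deriv_def)
next
  assume u: "(\<forall>s. u (s + L) = u s) \<and>
    (\<forall>s. (u has_vector_derivative \<i> * (w s - of_real t * u s)) (at s))"
  then have "continuous_on UNIV u"
    by (auto simp: continuous_on_eq_continuous_at intro: has_vector_derivative_continuous)
  then have "continuous_on UNIV (\<lambda>s. \<i> * (w s - of_real t * u s))"
    by (intro continuous_intros w)
  then have "H1_deriv L u (\<lambda>s. \<i> * (w s - of_real t * u s))"
    using u by (intro H1_deriv_of_C1) auto
  then show "shifted_momentum L t u w"
    unfolding shifted_momentum_def
    by (intro exI[where x = "\<lambda>s. \<i> * (w s - of_real t * u s)"] conjI) (auto simp: algebra_simps)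
qed

lemma shifted_momentum_cong_AE:
  assumes "AE s in lborel. f s = g s" and "shifted_momentum L t u f"
  shows "shifted_momentum L t u g"
proof -
  from assms(2) obtain v where v: "H1_deriv L u v"
    and AE: "AE s in lborel. f s = - \<i> * v s + of_real t * u s"
    unfolding shifted_momentum_def by blast
  from assms(1) AE have "AE s in lborel. g s = - \<i> * v s + of_real t * u s"
    by eventually_elim simp
  with v show ?thesis unfolding shifted_momentum_def by blast
qed

text \<open>The second-order eigenvalue equation as a first-order system for \<open>u\<close> and \<open>w = (D\<^sub>s + t) u\<close>. For the
  operator only the values of \<open>(D\<^sub>s + t) w\<close> up to null sets count; for an eigenfunction they agree almost
  everywhere with the continuous function \<open>(z + \<kappa>\<^sup>2/12) u\<close>, to which the regularity step applies.\<close>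

lemma Q_eff_eigenspace_iff_classical:
  assumes "0 < L" and curv: "\<And>s. (curvature \<gamma> s)\<^sup>2 = \<kappa>2"
  shows "u \<in> eigenspace (Q_eff h \<Omega> L \<gamma>) z \<longleftrightarrow>
    (\<exists>w. (\<forall>s. u (s + L) = u s) \<and> (\<forall>s. w (s + L) = w s) \<and>
      (\<forall>s. (u has_vector_derivative \<i> * (w s - of_real (t_eff h \<Omega> L) * u s)) (at s)) \<and>
      (\<forall>s. (w has_vector_derivative
        \<i> * ((z + of_real (\<kappa>2 / 12)) * u s - of_real (t_eff h \<Omega> L) * w s)) (at s)))"
    (is "_ \<longleftrightarrow> (\<exists>w. ?P w)")
proof -
  let ?t = "t_eff h \<Omega> L"
  let ?f = "\<lambda>s. (z + of_real (\<kappa>2 / 12)) * u s"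
  have "u \<in> eigenspace (Q_eff h \<Omega> L \<gamma>) z \<longleftrightarrow>
      (\<exists>w. shifted_momentum L ?t u w \<and> shifted_momentum L ?t w ?f)"
  proof
    assume "u \<in> eigenspace (Q_eff h \<Omega> L \<gamma>) z"
    then obtain w g where w: "shifted_momentum L ?t u w" and g: "shifted_momentum L ?t w g"
      and AE: "AE s in lborel. z * u s = g s - of_real (\<kappa>2 / 12) * u s"
      by (auto simp: eigenspace_def Q_eff_def curv)
    from AE have "AE s in lborel. g s = ?f s"
      by eventually_elim (simp add: algebra_simps)
    from w shifted_momentum_cong_AE[OF this g]
    show "\<exists>w. shifted_momentum L ?t u w \<and> shifted_momentum L ?t w ?f" by blast
  next
    assume "\<exists>w. shifted_momentum L ?t u w \<and> shifted_momentum L ?t w ?f"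
    then obtain w where "shifted_momentum L ?t u w" "shifted_momentum L ?t w ?f" by blast
    moreover have "AE s in lborel. z * u s = ?f s - of_real (\<kappa>2 / 12) * u s"
      by (simp add: algebra_simps)
    ultimately show "u \<in> eigenspace (Q_eff h \<Omega> L \<gamma>) z"
      unfolding eigenspace_def Q_eff_def curv mem_Collect_eq by blast
  qed
  also have "\<dots> \<longleftrightarrow> (\<exists>w. ?P w)"
  proof (intro ex_cong1 iffI)
    fix w
    assume w: "shifted_momentum L ?t u w \<and> shifted_momentum L ?t w ?f"
    then have "continuous_on UNIV u" "continuous_on UNIV w"
      using \<open>0 < L\<close> shifted_momentum_imp_continuous by blast+
    moreover from this have "continuous_on UNIV ?f" by (intro continuous_intros)
    ultimately show "?P w"
      using w \<open>0 < L\<close> shifted_momentum_iff_classical[of L w ?t u] shifted_momentum_iff_classical[of L ?f ?t w]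
      by blast
  next
    fix w
    assume w: "?P w"
    then have "continuous_on UNIV u" "continuous_on UNIV w"
      by (auto simp: continuous_on_eq_continuous_at intro: has_vector_derivative_continuous)
    moreover from this have "continuous_on UNIV ?f" by (intro continuous_intros)
    ultimately show "shifted_momentum L ?t u w \<and> shifted_momentum L ?t w ?f"
      using w \<open>0 < L\<close> shifted_momentum_iff_classical[of L w ?t u] shifted_momentum_iff_classical[of L ?f ?t w]
      by blast
  qed
  finally show ?thesis .
qed

section \<open>Fourier modes\<close>

definition fourier_mode :: "real \<Rightarrow> int \<Rightarrow> real \<Rightarrow> complex" where
  "fourier_mode R k s = exp (\<i> * of_real (of_int k / R) * of_real s)"

lemma fourier_mode_0 [simp]: "fourier_mode R k 0 = 1"
  by (simp add: fourier_mode_def)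

lemma fourier_mode_mult: "fourier_mode R j s * fourier_mode R k s = fourier_mode R (j + k) s"
  by (simp add: fourier_mode_def exp_add[symmetric] add_divide_distrib algebra_simps)

lemma fourier_mode_periodic:
  assumes "0 < R"
  shows "fourier_mode R k (s + 2 * pi * R) = fourier_mode R k s"
proof -
  have "exp (\<i> * of_real (of_int k / R) * of_real (2 * pi * R)) = 1"
    using assms by (auto simp: exp_eq_1)
  then show ?thesis
    by (simp add: fourier_mode_def distrib_left exp_add del: of_real_mult)
qed

lemma has_vector_derivative_fourier_mode:
  "(fourier_mode R k has_vector_derivative \<i> * of_real (of_int k / R) * fourier_mode R k s) (at s)"
  unfolding fourier_mode_def[abs_def] by (rule has_vector_derivative_exp_linear)

text \<open>The exponent \<open>a\<close> is a priori complex; a nonzero exponential \<open>exp (i a s)\<close> has the period \<open>2\<pi>R\<close> only if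
  \<open>a\<close> is real and \<open>a R\<close> is an integer.\<close>

lemma periodic_exponential_is_fourier_mode:
  assumes "0 < R"
    and deriv: "\<And>s. (p has_vector_derivative \<i> * a * p s) (at s)"
    and per: "\<And>s. p (s + 2 * pi * R) = p s"
  shows "p = (\<lambda>s. 0) \<or>
    (\<exists>k. a = of_real (of_int k / R) \<and> p = (\<lambda>s. p 0 * fourier_mode R k s))"
proof (cases "p 0 = 0")
  case True
  then have "p s = 0" for s using exponential_of_ode[OF deriv, of s] by simp
  then show ?thesis by auto
next
  case False
  have "exp (\<i> * a * of_real (2 * pi * R)) = 1"
    using exponential_of_ode[OF deriv, of "2 * pi * R"] per[of 0] False by simp
  then obtain k :: int where "Im a * R = 0" "Re a * R = of_int k"
    by (auto simp: exp_eq_1)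
  then have "a = of_real (of_int k / R)"
    using assms(1) by (auto simp: complex_eq_iff field_simps)
  moreover have "p s = p 0 * fourier_mode R k s" for s
    using exponential_of_ode[OF deriv, of s] calculation by (simp add: fourier_mode_def)
  ultimately show ?thesis by blast
qed

text \<open>Modes are eigenfunctions of \<open>d/ds\<close> for distinct eigenvalues. In the induction step a vanishing
  combination is divided by one of its modes and then differentiated: this removes the divided mode and
  multiplies the other coefficients by nonzero constants.\<close>

lemma fourier_modes_scalars_zero:
  assumes "finite A" "0 < R" "\<And>s. (\<Sum>k\<in>A. c k * fourier_mode R k s) = 0" "j \<in> A"
  shows "c j = 0"
  using assms(1,3,4)
proof (induction A arbitrary: c j)
  case (insert i A)
  let ?e = "\<lambda>k. fourier_mode R (k - i)"
  have shifted: "c i + (\<Sum>k\<in>A. c k * ?e k s) = 0" for s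
  proof -
    have "0 = (\<Sum>k\<in>insert i A. c k * fourier_mode R k s) * fourier_mode R (- i) s"
      using insert.prems by simp
    also have "\<dots> = (\<Sum>k\<in>insert i A. c k * ?e k s)"
      unfolding sum_distrib_right mult.assoc fourier_mode_mult by simp
    also have "\<dots> = c i + (\<Sum>k\<in>A. c k * ?e k s)"
      using insert.hyps by (simp add: fourier_mode_def)
    finally show ?thesis by simp
  qed
  define d where "d k = c k * (\<i> * of_real (of_int (k - i) / R))" for k
  have "(\<Sum>k\<in>A. d k * fourier_mode R k s) = 0" for s
  proof -
    have "((\<lambda>s. c i + (\<Sum>k\<in>A. c k * ?e k s)) has_vector_derivative
        0 + (\<Sum>k\<in>A. c k * (\<i> * of_real (of_int (k - i) / R) * ?e k s))) (at s)"
      by (intro has_vector_derivative_add has_vector_derivative_const has_vector_derivative_sum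
          has_vector_derivative_mult_right has_vector_derivative_fourier_mode)
    moreover have "(\<lambda>s. c i + (\<Sum>k\<in>A. c k * ?e k s)) = (\<lambda>s. 0)"
      using shifted by auto
    ultimately have "((\<lambda>s. 0) has_vector_derivative
        0 + (\<Sum>k\<in>A. c k * (\<i> * of_real (of_int (k - i) / R) * ?e k s))) (at s)"
      by (simp only:)
    from vector_derivative_unique_at[OF this has_vector_derivative_const]
    have "(\<Sum>k\<in>A. c k * (\<i> * of_real (of_int (k - i) / R) * ?e k s)) = 0"
      by (simp only: add_0)
    then have "0 = (\<Sum>k\<in>A. d k * ?e k s) * fourier_mode R i s"
      by (simp add: d_def mult.assoc)
    also have "\<dots> = (\<Sum>k\<in>A. d k * fourier_mode R k s)"
      unfolding sum_distrib_right mult.assoc fourier_mode_mult by simp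
    finally show ?thesis by simp
  qed
  then have "d k = 0" if "k \<in> A" for k using insert.IH that by blast
  then have cA: "c k = 0" if "k \<in> A" for k
    using that insert.hyps \<open>0 < R\<close> by (fastforce simp: d_def)
  then have "c i = 0" using shifted[of 0] by simp
  with cA show ?case using insert.prems by auto
qed simp

lemma inj_fourier_mode:
  assumes "0 < R"
  shows "inj (fourier_mode R)"
proof (rule injI, rule ccontr)
  fix j k
  assume eq: "fourier_mode R j = fourier_mode R k" and "j \<noteq> k"
  have "(\<Sum>i\<in>{j, k}. (if i = j then 1 else - 1) * fourier_mode R i s) = 0" for s
    using \<open>j \<noteq> k\<close> eq by simp
  from fourier_modes_scalars_zero[OF _ assms this, of j] show False by simp
qed

lemma sum_fun_apply: "(\<Sum>i\<in>A. f i) x = (\<Sum>i\<in>A. f i x)"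
  by (induction A rule: infinite_finite_induct) auto

lemma independent_fourier_modes:
  assumes "finite A" "0 < R"
  shows "\<not> cfun.dependent (fourier_mode R ` A)"
proof
  assume "cfun.dependent (fourier_mode R ` A)"
  then obtain u where u: "\<exists>v\<in>fourier_mode R ` A. u v \<noteq> 0"
      and sum: "(\<Sum>v\<in>fourier_mode R ` A. (\<lambda>x. u v * v x)) = 0"
    using cfun.dependent_finite[of "fourier_mode R ` A"] assms by auto
  have "(\<Sum>k\<in>A. u (fourier_mode R k) * fourier_mode R k s) = 0" for s
  proof -
    have "inj_on (fourier_mode R) A"
      using inj_fourier_mode[OF \<open>0 < R\<close>] by (rule inj_on_subset) simp
    then have "(\<Sum>v\<in>fourier_mode R ` A. (\<lambda>x. u v * v x)) s
        = (\<Sum>k\<in>A. u (fourier_mode R k) * fourier_mode R k s)"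
      by (simp add: sum_fun_apply sum.reindex)
    then show ?thesis by (simp add: sum)
  qed
  from fourier_modes_scalars_zero[OF assms this] u show False by auto
qed

section \<open>The eigenspaces\<close>

text \<open>If \<open>\<rho>\<^sup>2 = \<mu>\<close>, then \<open>w + \<rho> u\<close> satisfies \<open>p' = i (\<rho> - t) p\<close>, which by periodicity makes it zero or a
  multiple of a mode \<open>k\<close> with \<open>k / R + t = \<rho>\<close>. For \<open>\<mu> \<noteq> 0\<close> the two roots \<open>\<plusminus>\<rho>\<close> recover \<open>u\<close> from the difference
  of \<open>w + \<rho> u\<close> and \<open>w - \<rho> u\<close>. For \<open>\<mu> = 0\<close> the roots coincide and only \<open>w\<close> is obtained; then periodicity of \<open>u\<close>
  excludes a Jordan block, so \<open>w = 0\<close> and \<open>u\<close> itself satisfies \<open>u' = - i t u\<close>.\<close>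

lemma eigenspace_eq_span_fourier_modes:
  assumes "0 < R" and L: "L = 2 * pi * R" and curv: "\<And>s. (curvature \<gamma> s)\<^sup>2 = \<kappa>2"
  shows "eigenspace (Q_eff h \<Omega> L \<gamma>) z = cfun.span (fourier_mode R `
    {k. of_real ((of_int k / R + t_eff h \<Omega> L)\<^sup>2 - \<kappa>2 / 12) = z})"
proof (rule equalityI)
  define t where "t = t_eff h \<Omega> L"
  define \<mu> where "\<mu> = z + of_real (\<kappa>2 / 12)"
  define K where "K = {k. (of_real (of_int k / R + t))\<^sup>2 = \<mu>}"
  define E where "E = eigenspace (Q_eff h \<Omega> L \<gamma>) z"
  have K: "{k. of_real ((of_int k / R + t_eff h \<Omega> L)\<^sup>2 - \<kappa>2 / 12) = z} = K"
    unfolding K_def \<mu>_def t_def by (intro Collect_cong) (simp add: diff_eq_eq)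
  have E_iff: "u \<in> E \<longleftrightarrow> (\<exists>w. (\<forall>s. u (s + L) = u s) \<and> (\<forall>s. w (s + L) = w s) \<and>
      (\<forall>s. (u has_vector_derivative \<i> * (w s - of_real t * u s)) (at s)) \<and>
      (\<forall>s. (w has_vector_derivative \<i> * (\<mu> * u s - of_real t * w s)) (at s)))" for u
    unfolding E_def t_def \<mu>_def
    by (rule Q_eff_eigenspace_iff_classical) (use \<open>0 < R\<close> L curv in auto)
  have in_spanI: "p \<in> cfun.span (fourier_mode R ` K)"
    if "p = (\<lambda>s. 0) \<or> (\<exists>k\<in>K. \<exists>c. p = (\<lambda>s. c * fourier_mode R k s))" for p
    using that cfun.span_zero cfun.span_scale[OF cfun.span_base]
    by (auto simp: zero_fun_def)
  have "E \<subseteq> cfun.span (fourier_mode R ` K)"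
  proof
    fix u
    assume "u \<in> E"
    then obtain w where per: "\<And>s. u (s + L) = u s" "\<And>s. w (s + L) = w s"
      and du: "\<And>s. (u has_vector_derivative \<i> * (w s - of_real t * u s)) (at s)"
      and dw: "\<And>s. (w has_vector_derivative \<i> * (\<mu> * u s - of_real t * w s)) (at s)"
      unfolding E_iff by blast
    have factor: "(\<lambda>s. w s + \<rho> * u s) = (\<lambda>s. 0) \<or>
        (\<exists>k\<in>K. \<exists>c. (\<lambda>s. w s + \<rho> * u s) = (\<lambda>s. c * fourier_mode R k s))"
      if \<rho>: "\<rho>\<^sup>2 = \<mu>" for \<rho>
    proof -
      have "((\<lambda>s. w s + \<rho> * u s) has_vector_derivative
          \<i> * (\<rho> - of_real t) * (w s + \<rho> * u s)) (at s)" for s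
      proof -
        have "((\<lambda>s. w s + \<rho> * u s) has_vector_derivative
            \<i> * (\<mu> * u s - of_real t * w s) + \<rho> * (\<i> * (w s - of_real t * u s))) (at s)"
          by (intro has_vector_derivative_add has_vector_derivative_mult_right du dw)
        then show ?thesis
          by (simp add: \<rho>[symmetric] power2_eq_square algebra_simps)
      qed
      from periodic_exponential_is_fourier_mode[OF \<open>0 < R\<close> this] per
      consider "(\<lambda>s. w s + \<rho> * u s) = (\<lambda>s. 0)"
        | k c where "\<rho> - of_real t = of_real (of_int k / R)"
          "(\<lambda>s. w s + \<rho> * u s) = (\<lambda>s. c * fourier_mode R k s)"
        by (auto simp: L)
      then show ?thesis
      proof cases
        case (2 k c)
        then have "\<rho> = of_real (of_int k / R + t)" by (simp add: algebra_simps)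
        then have "k \<in> K" using \<rho> by (simp add: K_def)
        with 2 show ?thesis by blast
      qed blast
    qed
    define \<rho> where "\<rho> = csqrt \<mu>"
    have \<rho>: "\<rho>\<^sup>2 = \<mu>" "(- \<rho>)\<^sup>2 = \<mu>" by (simp_all add: \<rho>_def)
    show "u \<in> cfun.span (fourier_mode R ` K)"
    proof (cases "\<mu> = 0")
      case False
      then have "\<rho> \<noteq> 0" using \<rho> by auto
      have "(\<lambda>x. 1 / (2 * \<rho>) * ((\<lambda>s. w s + \<rho> * u s) - (\<lambda>s. w s + - \<rho> * u s)) x)
          \<in> cfun.span (fourier_mode R ` K)"
        by (intro cfun.span_scale cfun.span_diff in_spanI factor \<rho>)
      also have "(\<lambda>x. 1 / (2 * \<rho>) * ((\<lambda>s. w s + \<rho> * u s) - (\<lambda>s. w s + - \<rho> * u s)) x) = u"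
        using \<open>\<rho> \<noteq> 0\<close> by (simp add: fun_eq_iff field_simps)
      finally show ?thesis .
    next
      case True
      \<comment> \<open>A nonzero \<open>w\<close> would be a Fourier mode resonant with \<open>u\<close>, which makes \<open>u\<close> grow linearly.\<close>
      have "w = (\<lambda>s. 0)"
      proof (rule ccontr)
        assume "w \<noteq> (\<lambda>s. 0)"
        then obtain k c where k: "k \<in> K" and w: "w = (\<lambda>s. c * fourier_mode R k s)"
          using factor[of 0] True by auto
        have t: "of_real t = - complex_of_real (of_int k / R)"
          using k True by (simp add: K_def add_eq_0_iff del: of_real_divide of_real_of_int_eq flip: of_real_minus of_real_add)
        \<comment> \<open>Divided by the mode \<open>k\<close>, the function \<open>u\<close> has the constant derivative \<open>i c\<close>.\<close>
        let ?g = "\<lambda>s. u s * fourier_mode R (- k) s - \<i> * c * of_real s"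
        have "(?g has_vector_derivative 0) (at s within UNIV)" for s :: real
        proof -
          have "(?g has_vector_derivative
              u s * (\<i> * of_real (of_int (- k) / R) * fourier_mode R (- k) s)
              + \<i> * (w s - of_real t * u s) * fourier_mode R (- k) s - \<i> * c * 1) (at s)"
            by (intro has_vector_derivative_diff has_vector_derivative_mult du
                has_vector_derivative_fourier_mode has_vector_derivative_mult_right)
              (auto intro!: derivative_eq_intros simp: has_vector_derivative_def scaleR_conv_of_real)
          moreover have "fourier_mode R k s * fourier_mode R (- k) s = 1"
            unfolding fourier_mode_mult by (simp add: fourier_mode_def)
          ultimately show ?thesis
            by (simp add: t w algebra_simps)
        qed
        then obtain b where b: "\<And>s. ?g s = b"
          using has_vector_derivative_zero_constant[OF convex_UNIV, of ?g] by auto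
        have "\<i> * c * of_real L = 0"
          using b[of L] b[of 0] per(1)[of 0] fourier_mode_periodic[OF \<open>0 < R\<close>, of "- k" 0]
          by (simp add: L)
        then have "c = 0" using \<open>0 < R\<close> L by simp
        with w \<open>w \<noteq> (\<lambda>s. 0)\<close> show False by simp
      qed
      then have "(u has_vector_derivative \<i> * (- of_real t) * u s) (at s)" for s
        using du[of s] by (simp add: algebra_simps)
      from periodic_exponential_is_fourier_mode[OF \<open>0 < R\<close> this] per
      consider "u = (\<lambda>s. 0)"
        | k c where "- of_real t = complex_of_real (of_int k / R)" "u = (\<lambda>s. c * fourier_mode R k s)"
        by (auto simp: L)
      then have "u = (\<lambda>s. 0) \<or> (\<exists>k\<in>K. \<exists>c. u = (\<lambda>s. c * fourier_mode R k s))"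
      proof cases
        case (2 k c)
        from 2(1) have "of_real (of_int k / R + t) = complex_of_real 0"
          unfolding of_real_add by (simp only: flip: 2(1)) simp
        then have "k \<in> K" using True by (simp add: K_def)
        with 2 show ?thesis by blast
      qed blast
      then show ?thesis by (rule in_spanI)
    qed
  qed
  then show "eigenspace (Q_eff h \<Omega> L \<gamma>) z \<subseteq> cfun.span (fourier_mode R `
    {k. of_real ((of_int k / R + t_eff h \<Omega> L)\<^sup>2 - \<kappa>2 / 12) = z})"
    unfolding K E_def .
  have "cfun.span (fourier_mode R ` K) \<subseteq> E"
  proof (rule cfun.span_minimal)
    show "fourier_mode R ` K \<subseteq> E"
    proof
      fix u
      assume "u \<in> fourier_mode R ` K"
      then obtain k where k: "k \<in> K" and u: "u = fourier_mode R k" by blast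
      define \<rho> where "\<rho> = complex_of_real (of_int k / R + t)"
      have \<rho>_sq: "\<rho> * \<rho> = \<mu>" using k by (simp add: K_def \<rho>_def power2_eq_square)
      have deriv: "(u has_vector_derivative \<i> * (\<rho> * u s - of_real t * u s)) (at s)" for s
        unfolding u using has_vector_derivative_fourier_mode[of R k s]
        by (simp add: \<rho>_def algebra_simps)
      have "((\<lambda>s. \<rho> * u s) has_vector_derivative
          \<i> * (\<mu> * u s - of_real t * (\<rho> * u s))) (at s)" for s
        using has_vector_derivative_mult_right[OF deriv, of \<rho> s]
        unfolding \<rho>_sq[symmetric] by (simp add: algebra_simps)
      then show "u \<in> E"
        unfolding E_iff
        using deriv fourier_mode_periodic[OF \<open>0 < R\<close>, of k]
        by (intro exI[where x = "\<lambda>s. \<rho> * u s"]) (simp add: u L)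
    qed
    show "cfun.subspace E"
      unfolding cfun.subspace_def
    proof (intro conjI ballI allI)
      show "0 \<in> E" unfolding E_iff
        by (rule exI[where x = "\<lambda>s. 0"]) (simp add: zero_fun_def)
    next
      fix u1 u2
      assume "u1 \<in> E" "u2 \<in> E"
      then obtain w1 w2 where
        "(\<forall>s. u1 (s + L) = u1 s) \<and> (\<forall>s. w1 (s + L) = w1 s)"
        "(\<forall>s. u2 (s + L) = u2 s) \<and> (\<forall>s. w2 (s + L) = w2 s)" and d:
        "\<And>s. (u1 has_vector_derivative \<i> * (w1 s - of_real t * u1 s)) (at s)"
        "\<And>s. (u2 has_vector_derivative \<i> * (w2 s - of_real t * u2 s)) (at s)"
        "\<And>s. (w1 has_vector_derivative \<i> * (\<mu> * u1 s - of_real t * w1 s)) (at s)"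
        "\<And>s. (w2 has_vector_derivative \<i> * (\<mu> * u2 s - of_real t * w2 s)) (at s)"
        unfolding E_iff by blast
      then show "u1 + u2 \<in> E" unfolding E_iff
        using has_vector_derivative_add[OF d(1,2)] has_vector_derivative_add[OF d(3,4)]
        by (intro exI[where x = "\<lambda>s. w1 s + w2 s"]) (simp add: plus_fun_def algebra_simps)
    next
      fix c u
      assume "u \<in> E"
      then obtain w where
        "(\<forall>s. u (s + L) = u s) \<and> (\<forall>s. w (s + L) = w s)" and d:
        "\<And>s. (u has_vector_derivative \<i> * (w s - of_real t * u s)) (at s)"
        "\<And>s. (w has_vector_derivative \<i> * (\<mu> * u s - of_real t * w s)) (at s)"
        unfolding E_iff by blast
      then show "(\<lambda>x. c * u x) \<in> E" unfolding E_iff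
        using has_vector_derivative_mult_right[OF d(1), of c] has_vector_derivative_mult_right[OF d(2), of c]
        by (intro exI[where x = "\<lambda>s. c * w s"]) (simp add: algebra_simps)
    qed
  qed
  then show "cfun.span (fourier_mode R `
    {k. of_real ((of_int k / R + t_eff h \<Omega> L)\<^sup>2 - \<kappa>2 / 12) = z}) \<subseteq> eigenspace (Q_eff h \<Omega> L \<gamma>) z"
    unfolding K E_def .
qed

section \<open>Enumerations\<close>

lemma eigenvalue_enumeration_card:
  assumes "eigenvalue_enumeration T e"
  shows "finite {n. 1 \<le> n \<and> of_real (e n) = z}"
    and "card {n. 1 \<le> n \<and> of_real (e n) = z} = cfun.dim (eigenspace T z)"
proof -
  obtain B where fin: "finite {n. 1 \<le> n \<and> of_real (e n) = z}" and ind: "\<not> cfun.dependent B"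
    and span: "cfun.span B = eigenspace T z" and card: "card B = card {n. 1 \<le> n \<and> of_real (e n) = z}"
    using assms unfolding eigenvalue_enumeration_def by blast
  show "finite {n. 1 \<le> n \<and> of_real (e n) = z}" by (rule fin)
  show "card {n. 1 \<le> n \<and> of_real (e n) = z} = cfun.dim (eigenspace T z)"
    using cfun.dim_span_eq_card_independent[OF ind] span card by simp
qed

text \<open>At the first index \<open>n\<close> where two enumerations \<open>f\<close> and \<open>g\<close> differ, say \<open>f n < g n\<close>, monotonicity keeps
  \<open>g\<close> above \<open>f n\<close> from \<open>n\<close> on. So \<open>g\<close> takes the value \<open>f n\<close> only at indices below \<open>n\<close>, where \<open>f\<close> takes it
  too, whereas \<open>f\<close> takes it once more at \<open>n\<close>. But both multiplicities are the dimension of the same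
  eigenspace.\<close>

lemma eigenvalue_enumeration_unique:
  assumes e: "eigenvalue_enumeration T e" and e': "eigenvalue_enumeration T e'" and "1 \<le> n"
  shows "e n = e' n"
  using \<open>1 \<le> n\<close>
proof (induction n rule: less_induct)
  case (less n)
  have not_less: "\<not> f n < g n"
    if f: "eigenvalue_enumeration T f" and g: "eigenvalue_enumeration T g"
      and eq: "\<And>i. 1 \<le> i \<Longrightarrow> i < n \<Longrightarrow> f i = g i" for f g
  proof
    assume "f n < g n"
    define z where "z = complex_of_real (f n)"
    let ?F = "{i. 1 \<le> i \<and> of_real (f i) = z}" and ?G = "{i. 1 \<le> i \<and> of_real (g i) = z}"
    have "i < n" if "1 \<le> i" "g i = f n" for i
      using g that \<open>f n < g n\<close> less.prems not_le_imp_less unfolding eigenvalue_enumeration_def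
      by (metis leD)
    then have "?G \<subseteq> ?F" "n \<notin> ?G" "n \<in> ?F"
      using less.prems eq \<open>f n < g n\<close> by (auto simp: z_def)
    then have "card ?G < card ?F"
      using eigenvalue_enumeration_card(1)[OF f] by (intro psubset_card_mono) auto
    then show False
      using eigenvalue_enumeration_card(2)[OF f] eigenvalue_enumeration_card(2)[OF g] by simp
  qed
  show ?case
    using not_less[OF e e'] not_less[OF e' e] less.IH by (metis linorder_cases)
qed

lemma nth_eigenvalue_eq:
  assumes "eigenvalue_enumeration T e" "1 \<le> n"
  shows "nth_eigenvalue T n = e n"
  unfolding nth_eigenvalue_def
  using assms eigenvalue_enumeration_unique by (intro the_equality) blast+

lemma greedy_enumeration_mono:
  fixes f :: "'a \<Rightarrow> real" and m :: "nat \<Rightarrow> 'a"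
  assumes m: "\<And>n. 1 \<le> n \<Longrightarrow> is_arg_min f (\<lambda>k. k \<notin> m ` {1..<n}) (m n)"
    and "1 \<le> i" "i \<le> j"
  shows "f (m i) \<le> f (m j)"
proof -
  have "m j \<notin> m ` {1..<i}"
    using m[of j] \<open>1 \<le> i\<close> \<open>i \<le> j\<close> by (auto simp: is_arg_min_def)
  then show ?thesis using m[OF \<open>1 \<le> i\<close>] by (auto simp: is_arg_min_def not_less)
qed

text \<open>An element \<open>k\<close> that is never chosen stays available at every stage, so every chosen element has a
  value at most \<open>f k\<close>. There are infinitely many chosen elements, but only finitely many elements have
  such a value.\<close>

lemma greedy_enumeration_bij:
  fixes f :: "'a \<Rightarrow> real" and m :: "nat \<Rightarrow> 'a"
  assumes m: "\<And>n. 1 \<le> n \<Longrightarrow> is_arg_min f (\<lambda>k. k \<notin> m ` {1..<n}) (m n)"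
    and fin: "\<And>x. finite {k. f k \<le> x}"
  shows "bij_betw m {1..} UNIV"
proof -
  have inj: "inj_on m {1..}"
  proof (rule linorder_inj_onI)
    fix i j :: nat
    assume "i < j" "i \<in> {1..}" "j \<in> {1..}"
    then have "m i \<in> m ` {1..<j}" "m j \<notin> m ` {1..<j}"
      using m[of j] by (auto simp: is_arg_min_def)
    then show "m i \<noteq> m j" by metis
  qed auto
  moreover have "k \<in> m ` {1..}" for k
  proof (rule ccontr)
    assume "k \<notin> m ` {1..}"
    then have "k \<notin> m ` {1..<n}" for n by auto
    then have "f (m n) \<le> f k" if "1 \<le> n" for n
      using m[OF that] unfolding is_arg_min_def by (meson not_less)
    then have "m ` {1..} \<subseteq> {j. f j \<le> f k}" by auto
    then have "finite (m ` {1..})" using fin finite_subset by blast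
    then show False using inj infinite_Ici[of "1::nat"] by (simp add: finite_image_iff)
  qed
  ultimately show ?thesis by (auto simp: bij_betw_def)
qed

lemma finite_bounded_affine_int:
  fixes R t x :: real
  assumes "0 < R"
  shows "finite {k::int. \<bar>of_int k / R + t\<bar> \<le> x}"
proof (rule finite_subset)
  show "{k::int. \<bar>of_int k / R + t\<bar> \<le> x} \<subseteq> {\<lfloor>(- x - t) * R\<rfloor>..\<lceil>(x - t) * R\<rceil>}"
  proof
    fix k :: int
    assume "k \<in> {k. \<bar>of_int k / R + t\<bar> \<le> x}"
    then have "(- x - t) * R \<le> of_int k" "of_int k \<le> (x - t) * R"
      using assms by (auto simp: abs_le_iff field_simps)
    then show "k \<in> {\<lfloor>(- x - t) * R\<rfloor>..\<lceil>(x - t) * R\<rceil>}"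
      by (simp add: floor_le_iff le_ceiling_iff)
  qed
qed simp

theorem proposition1p21:
  fixes c :: complex and R h L :: real and \<Omega> :: "complex set"
    and \<gamma> :: "real \<Rightarrow> complex" and m :: "nat \<Rightarrow> int"
  assumes "0 < R" and "0 < h"
    and "\<Omega> = ball c R"
    and "arclength_param \<gamma> L (frontier \<Omega>)"
    and "\<And>n. 1 \<le> n \<Longrightarrow>
      is_arg_min (\<lambda>k::int. \<bar>of_int k / R + t_eff h \<Omega> L\<bar>) (\<lambda>k. k \<notin> m ` {1..<n}) (m n)"
  shows "\<forall>n\<ge>1. nth_eigenvalue (Q_eff h \<Omega> L \<gamma>) n =
    \<bar>of_int (m n) / R + t_eff h \<Omega> L\<bar>\<^sup>2 - 1 / (12 * R\<^sup>2)"
proof -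
  define t where "t = t_eff h \<Omega> L"
  define e where "e n = \<bar>of_int (m n) / R + t\<bar>\<^sup>2 - 1 / (12 * R\<^sup>2)" for n
  have \<gamma>: "arclength_param \<gamma> L (sphere c R)"
    using assms(3,4) \<open>0 < R\<close> by simp
  note m = assms(5)[folded t_def]
  have fin: "finite {k::int. \<bar>of_int k / R + t\<bar> \<le> x}" for x
    using \<open>0 < R\<close> by (rule finite_bounded_affine_int)
  have bij: "bij_betw m {1..} UNIV"
    using m fin by (rule greedy_enumeration_bij)
  have "eigenvalue_enumeration (Q_eff h \<Omega> L \<gamma>) e"
    unfolding eigenvalue_enumeration_def
  proof (intro conjI allI impI)
    fix i j :: nat
    assume "1 \<le> i" "i \<le> j"
    then have "\<bar>of_int (m i) / R + t\<bar> \<le> \<bar>of_int (m j) / R + t\<bar>"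
      using greedy_enumeration_mono[OF m] by blast
    then show "e i \<le> e j" unfolding e_def by (intro diff_right_mono power_mono) auto
  next
    fix z :: complex
    let ?N = "{n. 1 \<le> n \<and> of_real (e n) = z}"
    define K where "K = {k. of_real ((of_int k / R + t)\<^sup>2 - 1 / R\<^sup>2 / 12) = z}"
    have "m ` ?N = K"
    proof -
      have "n \<in> ?N \<longleftrightarrow> 1 \<le> n \<and> m n \<in> K" for n
        by (simp add: K_def e_def mult.commute)
      then show ?thesis using bij by (force simp: bij_betw_def)
    qed
    moreover have "inj_on m ?N"
      using bij by (auto simp: bij_betw_def intro: inj_on_subset)
    ultimately have N: "bij_betw m ?N K" by (simp add: bij_betw_def)
    have "finite K"
    proof (cases "K = {}")
      case False
      then obtain j where "j \<in> K" by blast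
      have "(of_int k / R + t)\<^sup>2 = (of_int j / R + t)\<^sup>2" if "k \<in> K" for k
      proof -
        have "complex_of_real ((of_int k / R + t)\<^sup>2 - 1 / R\<^sup>2 / 12)
            = complex_of_real ((of_int j / R + t)\<^sup>2 - 1 / R\<^sup>2 / 12)"
          using that \<open>j \<in> K\<close> unfolding K_def by (simp only: mem_Collect_eq)
        then show ?thesis unfolding of_real_eq_iff by simp
      qed
      then have "K \<subseteq> {k. \<bar>of_int k / R + t\<bar> \<le> \<bar>of_int j / R + t\<bar>}"
        by (auto simp: abs_le_square_iff)
      then show ?thesis using fin finite_subset by blast
    qed simp
    then show "finite ?N" using N by (simp add: bij_betw_finite)
    show "\<exists>B. finite B \<and> \<not> cfun.dependent B \<and>
        cfun.span B = eigenspace (Q_eff h \<Omega> L \<gamma>) z \<and> card B = card ?N"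
    proof (intro exI conjI)
      show "finite (fourier_mode R ` K)" using \<open>finite K\<close> by simp
      show "\<not> cfun.dependent (fourier_mode R ` K)"
        using \<open>finite K\<close> \<open>0 < R\<close> by (rule independent_fourier_modes)
      show "cfun.span (fourier_mode R ` K) = eigenspace (Q_eff h \<Omega> L \<gamma>) z"
        unfolding K_def t_def
        using eigenspace_eq_span_fourier_modes[OF \<open>0 < R\<close>] arclength_param_sphere[OF \<open>0 < R\<close> \<gamma>]
        by blast
      have "card (fourier_mode R ` K) = card K"
        using inj_fourier_mode[OF \<open>0 < R\<close>] by (intro card_image) (rule inj_on_subset, auto)
      then show "card (fourier_mode R ` K) = card ?N"
        using bij_betw_same_card[OF N] by simp
    qed
  qed
  then show ?thesis using nth_eigenvalue_eq by (auto simp: e_def t_def)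
qed

end
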